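(* Let $L>0$ and let $n\ge 2$ be an integer. The third order explicit SSP Runge--Kutta method SSPRK($n^2$,3) is not strongly stable for $\frac{d}{dt}u(t)=g(u(t))$, $u(0)=u_0$, for all smooth and semibounded $g$ with $|g|_{\mathrm{Lip}}\le L$; that is, there is a smooth and semibounded $g$ with $|g|_{\mathrm{Lip}}\le L$ for which SSPRK($n^2$,3) is not strongly stable.
   Context: ODE setting: $\mathcal{H}$ is a real vector space with semi inner product $\langle\cdot,\cdot\rangle$ and induced seminorm $\|\cdot\|$ (e.g. a real Hilbert space such as $\mathbb{R}^2$ with the Euclidean inner product), $g\colon\mathcal{H}\to\mathcal{H}$, and the autonomous ODE is $\frac{d}{dt}u(t)=g(u(t))$, $u(0)=u_0\in\mathcal{H}$. The function $g$ is semibounded if $\langle u,g(u)\rangle\le 0$ for all $u\in\mathcal{H}$. Its Lipschitz seminorm is $|g|_{\mathrm{Lip}}=\sup_{u\ne v}\|g(u)-g(v)\|/\|u-v\|$. Smooth means infinitely differentiable. "For all $g$" refers to all such spaces $\mathcal{H}$ and all such $g$ on them. Strong stability: a one-step method mapping $u_0$ to $u_+$ with step size $\Delta t$ is strongly stable for the ODE with semibounded $g$ if there is $\Delta t_{\max}>0$ (possibly depending on $g$) such that $\|u_+\|^2\le\|u_0\|^2$ for all $u_0\in\mathcal{H}$ and all $\Delta t\in(0,\Delta t_{\max}]$. The method SSPRK($n^2$,3), $n\ge2$: one step from $u_0$ to $u_+$ is $$u_k=u_{k-1}+\frac{\Delta t}{n(n-1)}g(u_{k-1}),\quad k\in\Big\{1,\dots,\tfrac{n(n+1)}2\Big\},$$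 $$v_0=\frac{n}{2n-1}u_{\frac{(n-1)(n-2)}2}+\frac{n-1}{2n-1}u_{\frac{n(n+1)}2},$$ $$v_k=v_{k-1}+\frac{\Delta t}{n(n-1)}g(v_{k-1}),\quad k\in\Big\{1,\dots,\tfrac{n(n-1)}2\Big\},\qquad u_+=v_{\frac{n(n-1)}2}.$$ *)

theory Defs
  imports "HOL-Analysis.Analysis"
begin

definition semibounded :: "('a::real_inner \<Rightarrow> 'a) \<Rightarrow> bool" where
  "semibounded g \<longleftrightarrow> (\<forall>u. u \<bullet> g u \<le> 0)"

text \<open>Valued in \<^typ>\<open>ennreal\<close>, since the supremum need not be finite.\<close>

definition lip_seminorm :: "('a::real_normed_vector \<Rightarrow> 'b::real_normed_vector) \<Rightarrow> ennreal" where
  "lip_seminorm g = (SUP (u, v) \<in> {(u, v). u \<noteq> v}. ennreal (norm (g u - g v) / norm (u - v)))"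

text \<open>
  The iterated Frechet derivatives have different types, so higher differentiability is
  expressed through the directional maps \<open>x \<mapsto> Df(x) v\<close>. On a finite-dimensional domain,
  \<open>Df\<close> is differentiable as an operator-valued map if and only if all of these are differentiable;
  this is why the domain is restricted to \<^class>\<open>euclidean_space\<close>.
\<close>

primrec times_differentiable ::
    "nat \<Rightarrow> ('a::euclidean_space \<Rightarrow> 'b::real_normed_vector) \<Rightarrow> bool" where
  "times_differentiable 0 f \<longleftrightarrow> True"
| "times_differentiable (Suc k) f \<longleftrightarrow>
     (\<forall>x. f differentiable (at x)) \<and>
     (\<forall>v. times_differentiable k (\<lambda>x. frechet_derivative f (at x) v))"

definition smooth :: "('a::euclidean_space \<Rightarrow> 'b::real_normed_vector) \<Rightarrow> bool" where
  "smooth f \<longleftrightarrow> (\<forall>k. times_differentiable k f)"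

text \<open>
  A one-step method for autonomous equations sends the right-hand side \<open>g\<close>, the step size and
  the initial value \<open>u\<^sub>0\<close> to the new value \<open>u\<^sub>+\<close>.
\<close>

type_synonym 'a one_step_method = "('a \<Rightarrow> 'a) \<Rightarrow> real \<Rightarrow> 'a \<Rightarrow> 'a"

definition strongly_stable :: "'a::real_normed_vector one_step_method \<Rightarrow> ('a \<Rightarrow> 'a) \<Rightarrow> bool" where
  "strongly_stable \<Phi> g \<longleftrightarrow>
     (\<exists>dtmax>0. \<forall>u0. \<forall>dt\<in>{0<..dtmax}. (norm (\<Phi> g dt u0))\<^sup>2 \<le> (norm u0)\<^sup>2)"

primrec euler_iterate :: "('a::real_vector \<Rightarrow> 'a) \<Rightarrow> real \<Rightarrow> 'a \<Rightarrow> nat \<Rightarrow> 'a" where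
  "euler_iterate g h w 0 = w"
| "euler_iterate g h w (Suc k) = euler_iterate g h w k + h *\<^sub>R g (euler_iterate g h w k)"

text \<open>
  One step of SSPRK(\<open>n\<^sup>2\<close>,3), for \<open>n \<ge> 2\<close>. The natural number divisions by 2 are exact,
  and the subtractions in them do not truncate for \<open>n \<ge> 2\<close>.
\<close>

definition SSPRK_nsq_3 :: "nat \<Rightarrow> 'a::real_vector one_step_method" where
  "SSPRK_nsq_3 n g dt u0 =
    (let h = dt / (real n * (real n - 1));
         u = euler_iterate g h u0;
         v0 = (real n / (2 * real n - 1)) *\<^sub>R u ((n - 1) * (n - 2) div 2)
            + ((real n - 1) / (2 * real n - 1)) *\<^sub>R u (n * (n + 1) div 2);
         v = euler_iterate g h v0
     in v (n * (n - 1) div 2))"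

end

theory Submission
  imports Defs
begin

text \<open>
  The instability comes from a field of rotations \<open>g\<close>, with \<open>u \<bullet> g u = 0\<close>, whose speed is a function
  of the radius alone, \<open>(norm (g u))\<^sup>2 = q ((norm u)\<^sup>2)\<close>, and decreases there. For such a field an
  Euler step with step size \<open>h\<close> from \<open>x\<close> raises the energy \<open>(norm x)\<^sup>2\<close> by exactly
  \<open>h\<^sup>2 * q ((norm x)\<^sup>2)\<close>, and only the convex combination \<open>v\<^sub>0\<close> loses energy. Bounding that loss by
  the Cauchy-Schwarz inequality leaves a lower bound \<open>h\<^sup>2 * B h\<close> for the gain in energy over one step
  of the method, where \<open>B h\<close> is a sum of the values of \<open>q\<close> at the stages whose weights add up to
  zero. So only the differences \<open>q - q\<^sub>0\<close> count, \<open>q\<^sub>0\<close> being the value at the initial state, and these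
  are determined to leading order by the energies of the stages to order \<open>h\<^sup>2\<close>.

  With \<open>c = n (n - 1) / 2\<close> and \<open>s\<^sub>0\<close> the initial energy, \<open>u\<^sub>k\<close> has energy about \<open>s\<^sub>0 + k h\<^sup>2 q\<^sub>0\<close>.
  If \<open>v\<^sub>0\<close> had the energy \<open>s\<^sub>0 + c h\<^sup>2 q\<^sub>0\<close> obtained by averaging \<open>(norm u\<^sub>k)\<^sup>2\<close>, the weighted sum would
  vanish to this order as well. But \<open>v\<^sub>0\<close> lies on a chord, which puts it at \<open>s\<^sub>0 - c h\<^sup>2 q\<^sub>0\<close>: the \<open>c\<close>
  stages of the second phase have \<open>2 c h\<^sup>2 q\<^sub>0\<close> less energy than that, and therefore
  \<open>B h / h\<^sup>2 \<longlonglongrightarrow> - 2 c\<^sup>2 q' q\<^sub>0\<close> as \<open>h\<close> tends to zero. When \<open>q' < 0\<close> this is positive: the second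
  phase runs at smaller radii, where the rotation is faster, and gains more energy than the chord
  has lost. This is \<open>SSPRK_nsq_3_not_strongly_stable\<close>, valid in every real inner product space.

  In the plane, \<open>L / (1 + u \<bullet> u)\<close> times the rotation by a right angle is such a field. It is smooth
  because the rational functions whose denominators are powers of \<open>1 + u \<bullet> u\<close> are closed under
  differentiation, and \<open>L\<close>-Lipschitz because \<open>x / (1 + x \<bullet> x)\<close> is a nonexpansive map. Its speed
  decreases outside the unit circle, so any initial state there will do.
\<close>

section \<open>Energy along explicit Euler steps\<close>

lemma euler_iterate_diff:
  assumes "a \<le> b"
  shows "euler_iterate g h w b - euler_iterate g h w a = h *\<^sub>R (\<Sum>j = a..<b. g (euler_iterate g h w j))"
  using assms by (induction b rule: dec_induct) (simp_all add: algebra_simps scaleR_add_right)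

lemma norm_sq_euler_iterate:
  assumes "\<And>u. u \<bullet> g u = 0"
  shows "(norm (euler_iterate g h w k))\<^sup>2
       = (norm w)\<^sup>2 + h\<^sup>2 * (\<Sum>j<k. (norm (g (euler_iterate g h w j)))\<^sup>2)"
proof (induction k)
  case (Suc k)
  have "(norm (x + h *\<^sub>R g x))\<^sup>2 = (norm x)\<^sup>2 + h\<^sup>2 * (norm (g x))\<^sup>2" for x
    using norm_add_Pythagorean[of x "h *\<^sub>R g x"] assms[of x]
    by (simp add: orthogonal_def power_mult_distrib)
  with Suc show ?case by (simp add: algebra_simps)
qed simp

text \<open>
  For \<open>g\<close> orthogonal to the state, the last term is the only place where a step of the method can
  lose energy.
\<close>

lemma norm_sq_convex_combination:
  fixes x y :: "'a::real_inner"
  assumes "\<alpha> + \<beta> = 1"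
  shows "(norm (\<alpha> *\<^sub>R x + \<beta> *\<^sub>R y))\<^sup>2
       = \<alpha> * (norm x)\<^sup>2 + \<beta> * (norm y)\<^sup>2 - \<alpha> * \<beta> * (norm (y - x))\<^sup>2"
proof -
  have \<beta>: "\<beta> = 1 - \<alpha>" using assms by simp
  show ?thesis
    unfolding \<beta> power2_norm_eq_inner
    by (simp add: inner_add_left inner_add_right inner_diff_left inner_diff_right
        inner_commute[of y x] algebra_simps)
qed

lemma norm_sum_sq_le_card:
  fixes f :: "'i \<Rightarrow> 'a::real_normed_vector"
  shows "(norm (\<Sum>i\<in>I. f i))\<^sup>2 \<le> real (card I) * (\<Sum>i\<in>I. (norm (f i))\<^sup>2)"
proof -
  have "(norm (\<Sum>i\<in>I. f i))\<^sup>2 \<le> (\<Sum>i\<in>I. norm (f i))\<^sup>2"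
    by (intro power_mono norm_sum norm_ge_zero)
  also have "\<dots> \<le> real (card I) * (\<Sum>i\<in>I. (norm (f i))\<^sup>2)"
    using sum_squared_le_sum_of_squares[of "\<lambda>i. norm (f i)" I]
    by (cases "finite I") (auto simp: mult.commute)
  finally show ?thesis .
qed

lemma tendsto_euler_iterate:
  fixes g :: "'a::real_normed_vector \<Rightarrow> 'a"
  assumes "isCont g x" and "(w \<longlongrightarrow> x) (at_right 0)"
  shows "((\<lambda>h. euler_iterate g h (w h) k) \<longlongrightarrow> x) (at_right 0)"
proof (induction k)
  case (Suc k)
  have "((\<lambda>h. euler_iterate g h (w h) k + h *\<^sub>R g (euler_iterate g h (w h) k)) \<longlongrightarrow> x + 0 *\<^sub>R g x)
          (at_right 0)"
    by (intro tendsto_intros Suc isCont_tendsto_compose[OF assms(1)])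
  then show ?case by simp
qed (use assms(2) in simp)

section \<open>Energy growth for rotations that slow down outwards\<close>

lemma real_triangular: "real (k * (k - 1) div 2) = real k * (real k - 1) / 2"
proof -
  have "even (k * (k - 1))" by auto
  then have "real (k * (k - 1) div 2) = real (k * (k - 1)) / 2"
    by (simp add: real_of_nat_div)
  then show ?thesis by (cases k) (auto simp: algebra_simps)
qed

lemma sum_lessThan_real: "(\<Sum>k<m. real k) = real m * (real m - 1) / 2"
  by (induction m) (simp_all add: field_simps)

text \<open>
  A chain rule along a filter: \<open>s\<close> is only known through the rate at which it approaches \<open>s0\<close>,
  measured in the scale \<open>e\<close>. It turns the energies of the stages, in the scale \<open>h\<^sup>2\<close>, into their
  speeds.
\<close>

lemma tendsto_difference_quotient_compose:
  fixes q :: "real \<Rightarrow> real" and s :: "real \<Rightarrow> real"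
  assumes q: "(q has_real_derivative q') (at s0)"
    and s: "(s \<longlongrightarrow> s0) F" and d: "((\<lambda>h. (s h - s0) / e h) \<longlongrightarrow> d) F"
  shows "((\<lambda>h. (q (s h) - q s0) / e h) \<longlongrightarrow> q' * d) F"
proof -
  obtain r where r: "\<And>z. q z - q s0 = r z * (z - s0)" "isCont r s0" "r s0 = q'"
    using q unfolding CARAT_DERIV by blast
  have "((\<lambda>h. r (s h) * ((s h - s0) / e h)) \<longlongrightarrow> r s0 * d) F"
    by (intro tendsto_intros d isCont_tendsto_compose[OF r(2) s])
  then show ?thesis by (simp add: r)
qed

text \<open>
  The gain in energy over one step is of order \<open>h ^ 4\<close>, but its sign follows from limits of the
  stages and from the single derivative \<open>q'\<close>. Two factors \<open>h\<close> are explicit in the energy balance,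
  and two more come from the energies of the stages, which differ from the initial one by sums
  multiplied by \<open>h\<^sup>2\<close>. So no Taylor expansion of \<open>g\<close> is involved, and continuity of \<open>g\<close> at the
  initial state suffices.
\<close>

theorem SSPRK_nsq_3_not_strongly_stable:
  fixes g :: "'a::real_inner \<Rightarrow> 'a" and q :: "real \<Rightarrow> real"
  assumes n: "n \<ge> 2"
    and orth: "\<And>u. u \<bullet> g u = 0"
    and q: "\<And>u. (norm (g u))\<^sup>2 = q ((norm u)\<^sup>2)"
    and cont: "isCont g u0" and nz: "g u0 \<noteq> 0"
    and q': "(q has_real_derivative q') (at ((norm u0)\<^sup>2))" "q' < 0"
  shows "\<not> strongly_stable (SSPRK_nsq_3 n) g"
proof -
  define a b c where "a = (n - 1) * (n - 2) div 2" and "b = n * (n + 1) div 2"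
    and "c = n * (n - 1) div 2"
  define \<alpha> \<beta> \<kappa> where "\<alpha> = real n / (2 * real n - 1)" and "\<beta> = (real n - 1) / (2 * real n - 1)"
    and "\<kappa> = (real n - 1)\<^sup>2 / (2 * real n - 1)"
  define s0 where "s0 = (norm u0)\<^sup>2"
  define q0 where "q0 = q s0"
  define u where "u h = euler_iterate g h u0" for h
  define v0 where "v0 h = \<alpha> *\<^sub>R u h a + \<beta> *\<^sub>R u h b" for h
  define v where "v h = euler_iterate g h (v0 h)" for h
  \<comment> \<open>\<open>- \<kappa>\<close> is the weight of the stages between \<open>u\<^sub>a\<close> and \<open>u\<^sub>b\<close>: the share \<open>\<beta>\<close> of the energy they gain
    minus the Cauchy-Schwarz bound for the loss on the chord.\<close>
  define B where "B h = (\<Sum>k<a. q ((norm (u h k))\<^sup>2) - q0) - \<kappa> * (\<Sum>k=a..<b. q ((norm (u h k))\<^sup>2) - q0)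
      + (\<Sum>k<c. q ((norm (v h k))\<^sup>2) - q0)" for h
  have q0: "q0 > 0"
    using q[of u0] nz unfolding q0_def s0_def by (metis norm_eq_zero zero_less_power2)
  have ab: "a \<le> b" unfolding a_def b_def by (intro div_le_mono mult_le_mono) auto
  have ra: "real a = (real n - 1) * (real n - 2) / 2"
    using real_triangular[of "n - 1"] n by (simp add: a_def of_nat_diff numeral_2_eq_2)
  have rb: "real b = real n * (real n + 1) / 2"
    using real_triangular[of "n + 1"] by (simp add: b_def mult.commute add.commute)
  have rc: "real c = real n * (real n - 1) / 2"
    using real_triangular[of n] by (simp add: c_def)
  have n2: "real n \<ge> 2" using n by simp
  have den: "2 * real n - 1 \<noteq> 0" using n2 by linarith
  have rba: "real b - real a = 2 * real n - 1" unfolding ra rb by (simp add: field_simps)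
  have \<alpha>\<beta>: "\<alpha> + \<beta> = 1" unfolding \<alpha>_def \<beta>_def using den by (simp add: divide_simps)
  have \<kappa>: "\<alpha> * \<beta> * (2 * real n - 1) - \<beta> = \<kappa>"
    unfolding \<alpha>_def \<beta>_def \<kappa>_def using den by (simp add: divide_simps power2_eq_square) (simp add: algebra_simps)
  \<comment> \<open>This cancellation removes the contribution \<open>q0\<close> that all stages have in common.\<close>
  have weights: "real a - \<kappa> * (real b - real a) + real c = 0"
    unfolding rba \<kappa>_def using den by (simp add: ra rc field_simps power2_eq_square)

  have u_lim: "((\<lambda>h. u h k) \<longlongrightarrow> u0) (at_right 0)" for k
    unfolding u_def by (intro tendsto_euler_iterate cont tendsto_const)
  have v0_lim: "(v0 \<longlongrightarrow> u0) (at_right 0)"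
  proof -
    have "((\<lambda>h. \<alpha> *\<^sub>R u h a + \<beta> *\<^sub>R u h b) \<longlongrightarrow> \<alpha> *\<^sub>R u0 + \<beta> *\<^sub>R u0) (at_right 0)"
      by (intro tendsto_intros u_lim)
    then show ?thesis by (simp add: v0_def[abs_def] scaleR_add_left[symmetric] \<alpha>\<beta>)
  qed
  have v_lim: "((\<lambda>h. v h k) \<longlongrightarrow> u0) (at_right 0)" for k
    unfolding v_def by (intro tendsto_euler_iterate cont v0_lim)
  have g_lim: "((\<lambda>h. (norm (g (x h)))\<^sup>2) \<longlongrightarrow> q0) (at_right 0)" if "(x \<longlongrightarrow> u0) (at_right 0)" for x
    using tendsto_power[OF tendsto_norm[OF isCont_tendsto_compose[OF cont that]], of 2]
    by (simp add: q q0_def s0_def)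
  have u_sq: "(norm (u h k))\<^sup>2 = s0 + h\<^sup>2 * (\<Sum>j<k. (norm (g (u h j)))\<^sup>2)" for h k
    unfolding u_def s0_def by (rule norm_sq_euler_iterate[OF orth])
  have v_sq: "(norm (v h k))\<^sup>2 = (norm (v0 h))\<^sup>2 + h\<^sup>2 * (\<Sum>j<k. (norm (g (v h j)))\<^sup>2)" for h k
    unfolding v_def by (rule norm_sq_euler_iterate[OF orth])
  have v0_sq: "(norm (v0 h))\<^sup>2 = s0 + h\<^sup>2 * (\<alpha> * (\<Sum>j<a. (norm (g (u h j)))\<^sup>2)
      + \<beta> * (\<Sum>j<b. (norm (g (u h j)))\<^sup>2) - \<alpha> * \<beta> * (norm (\<Sum>j=a..<b. g (u h j)))\<^sup>2)" for h
  proof -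
    have "u h b - u h a = h *\<^sub>R (\<Sum>j=a..<b. g (u h j))"
      unfolding u_def by (rule euler_iterate_diff[OF ab])
    then have "(norm (v0 h))\<^sup>2 = \<alpha> * (norm (u h a))\<^sup>2 + \<beta> * (norm (u h b))\<^sup>2
        - \<alpha> * \<beta> * (h\<^sup>2 * (norm (\<Sum>j=a..<b. g (u h j)))\<^sup>2)"
      unfolding v0_def norm_sq_convex_combination[OF \<alpha>\<beta>] by (simp add: power_mult_distrib)
    also have "\<dots> = (\<alpha> + \<beta>) * s0 + h\<^sup>2 * (\<alpha> * (\<Sum>j<a. (norm (g (u h j)))\<^sup>2)
      + \<beta> * (\<Sum>j<b. (norm (g (u h j)))\<^sup>2) - \<alpha> * \<beta> * (norm (\<Sum>j=a..<b. g (u h j)))\<^sup>2)"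
      unfolding u_sq by (simp only: ring_distribs) (simp add: mult_ac)
    finally show ?thesis by (simp add: \<alpha>\<beta>)
  qed

  have energy: "h\<^sup>2 * B h \<le> (norm (v h c))\<^sup>2 - s0" for h
  proof -
    let ?G = "\<lambda>j. (norm (g (u h j)))\<^sup>2" and ?S = "\<Sum>j=a..<b. (norm (g (u h j)))\<^sup>2"
    have split: "(\<Sum>j<b. ?G j) = (\<Sum>j<a. ?G j) + ?S"
      using sum.atLeastLessThan_concat[of 0 a b ?G] ab by (simp add: atLeast0LessThan)
    have "(norm (\<Sum>j=a..<b. g (u h j)))\<^sup>2 \<le> (2 * real n - 1) * ?S"
      using norm_sum_sq_le_card[of "\<lambda>j. g (u h j)" "{a..<b}"] ab by (simp add: of_nat_diff rba)
    then have "\<alpha> * \<beta> * (norm (\<Sum>j=a..<b. g (u h j)))\<^sup>2 \<le> \<alpha> * \<beta> * ((2 * real n - 1) * ?S)"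
      using n2 by (intro mult_left_mono) (simp_all add: \<alpha>_def \<beta>_def)
    also have "\<dots> = (\<kappa> + \<beta>) * ?S" by (simp flip: \<kappa>)
    finally have cs: "\<alpha> * \<beta> * (norm (\<Sum>j=a..<b. g (u h j)))\<^sup>2 \<le> (\<kappa> + \<beta>) * ?S" .
    have "B h = (\<Sum>j<a. ?G j) - \<kappa> * ?S + (\<Sum>j<c. (norm (g (v h j)))\<^sup>2)
        - q0 * (real a - \<kappa> * (real b - real a) + real c)"
      unfolding B_def using ab by (simp add: sum_subtractf q of_nat_diff algebra_simps)
    also have "\<dots> = (\<alpha> + \<beta>) * (\<Sum>j<a. ?G j) - \<kappa> * ?S + (\<Sum>j<c. (norm (g (v h j)))\<^sup>2)"
      by (simp add: weights \<alpha>\<beta>)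
    also have "\<dots> \<le> \<alpha> * (\<Sum>j<a. ?G j) + \<beta> * (\<Sum>j<b. ?G j)
        - \<alpha> * \<beta> * (norm (\<Sum>j=a..<b. g (u h j)))\<^sup>2 + (\<Sum>j<c. (norm (g (v h j)))\<^sup>2)"
      using cs unfolding split by (simp add: ring_distribs)
    finally have "h\<^sup>2 * B h \<le> h\<^sup>2 * \<dots>" by (intro mult_left_mono) auto
    then show ?thesis unfolding v_sq v0_sq by (simp add: ring_distribs)
  qed

  have h_pos: "\<forall>\<^sub>F h::real in at_right 0. h > 0" by (simp add: eventually_at_right_less)
  have lim_cong: "(f \<longlongrightarrow> l) (at_right 0)" if "(f' \<longlongrightarrow> l) (at_right 0)" "\<And>h. h > 0 \<Longrightarrow> f' h = f h"
    for f f' :: "real \<Rightarrow> real" and l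
    using that(1) by (rule Lim_transform_eventually) (use h_pos that(2) in \<open>auto elim: eventually_mono\<close>)
  have u_rate: "((\<lambda>h. ((norm (u h k))\<^sup>2 - s0) / h\<^sup>2) \<longlongrightarrow> real k * q0) (at_right 0)" for k
  proof -
    have "((\<lambda>h. \<Sum>j<k. (norm (g (u h j)))\<^sup>2) \<longlongrightarrow> (\<Sum>j<k. q0)) (at_right 0)"
      by (intro tendsto_sum g_lim u_lim)
    then have "((\<lambda>h. ((norm (u h k))\<^sup>2 - s0) / h\<^sup>2) \<longlongrightarrow> (\<Sum>j<k. q0)) (at_right 0)"
      by (rule lim_cong) (simp add: u_sq)
    then show ?thesis by simp
  qed
  \<comment> \<open>The average of the energies is \<open>c * q0\<close> above \<open>s0\<close> in the scale \<open>h\<^sup>2\<close>; the chord costs twice as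
    much, since the two combined stages are \<open>2 * n - 1\<close> nearly parallel steps apart.\<close>
  have v0_rate: "((\<lambda>h. ((norm (v0 h))\<^sup>2 - s0) / h\<^sup>2) \<longlongrightarrow> - real c * q0) (at_right 0)"
  proof -
    have "((\<lambda>h. \<alpha> * (\<Sum>j<a. (norm (g (u h j)))\<^sup>2) + \<beta> * (\<Sum>j<b. (norm (g (u h j)))\<^sup>2)
          - \<alpha> * \<beta> * (norm (\<Sum>j=a..<b. g (u h j)))\<^sup>2)
        \<longlongrightarrow> \<alpha> * (\<Sum>j<a. q0) + \<beta> * (\<Sum>j<b. q0) - \<alpha> * \<beta> * (norm (\<Sum>j=a..<b. g u0))\<^sup>2)
        (at_right 0)"
      by (intro tendsto_intros g_lim u_lim isCont_tendsto_compose[OF cont])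
    moreover have "\<alpha> * (\<Sum>j<a. q0) + \<beta> * (\<Sum>j<b. q0) - \<alpha> * \<beta> * (norm (\<Sum>j=a..<b. g u0))\<^sup>2 = - real c * q0"
    proof -
      have 1: "\<alpha> * real a + \<beta> * real b = real c"
        unfolding \<alpha>_def \<beta>_def ra rb rc using den by (simp add: divide_simps) (simp add: algebra_simps)
      have 2: "\<alpha> * \<beta> * (2 * real n - 1)\<^sup>2 = 2 * real c"
        unfolding \<alpha>_def \<beta>_def rc using den by (simp add: power2_eq_square)
      have "(norm (\<Sum>j=a..<b. g u0))\<^sup>2 = (2 * real n - 1)\<^sup>2 * q0"
        using ab by (simp add: sum_constant_scaleR of_nat_diff rba power_mult_distrib q q0_def s0_def)
      then have "\<alpha> * (\<Sum>j<a. q0) + \<beta> * (\<Sum>j<b. q0) - \<alpha> * \<beta> * (norm (\<Sum>j=a..<b. g u0))\<^sup>2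
          = (\<alpha> * real a + \<beta> * real b - \<alpha> * \<beta> * (2 * real n - 1)\<^sup>2) * q0"
        by (simp add: algebra_simps)
      then show ?thesis unfolding 1 2 by simp
    qed
    ultimately show ?thesis
      by (elim lim_cong[OF tendsto_eq_rhs]) (simp_all add: v0_sq)
  qed
  have v_rate: "((\<lambda>h. ((norm (v h k))\<^sup>2 - s0) / h\<^sup>2) \<longlongrightarrow> (real k - real c) * q0) (at_right 0)" for k
  proof -
    have "((\<lambda>h. ((norm (v0 h))\<^sup>2 - s0) / h\<^sup>2 + (\<Sum>j<k. (norm (g (v h j)))\<^sup>2))
        \<longlongrightarrow> - real c * q0 + (\<Sum>j<k. q0)) (at_right 0)"
      by (intro tendsto_intros v0_rate g_lim v_lim)
    then have "((\<lambda>h. ((norm (v h k))\<^sup>2 - s0) / h\<^sup>2) \<longlongrightarrow> - real c * q0 + (\<Sum>j<k. q0)) (at_right 0)"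
      by (rule lim_cong) (simp add: v_sq[of _ k] field_simps)
    then show ?thesis by (simp add: algebra_simps)
  qed
  have q_rate: "((\<lambda>h. (q ((norm (x h))\<^sup>2) - q0) / h\<^sup>2) \<longlongrightarrow> q' * d) (at_right 0)"
    if "(x \<longlongrightarrow> u0) (at_right 0)" "((\<lambda>h. ((norm (x h))\<^sup>2 - s0) / h\<^sup>2) \<longlongrightarrow> d) (at_right 0)" for x d
    unfolding q0_def
    by (intro tendsto_difference_quotient_compose that(2))
      (use q'(1) that(1) in \<open>auto simp: s0_def intro!: tendsto_intros\<close>)
  have "((\<lambda>h. B h / h\<^sup>2) \<longlongrightarrow> - 2 * (real c)\<^sup>2 * q' * q0) (at_right 0)"
  proof -
    have "((\<lambda>h. (\<Sum>k<a. (q ((norm (u h k))\<^sup>2) - q0) / h\<^sup>2)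
          - \<kappa> * (\<Sum>k=a..<b. (q ((norm (u h k))\<^sup>2) - q0) / h\<^sup>2)
          + (\<Sum>k<c. (q ((norm (v h k))\<^sup>2) - q0) / h\<^sup>2))
        \<longlongrightarrow> (\<Sum>k<a. q' * (real k * q0)) - \<kappa> * (\<Sum>k=a..<b. q' * (real k * q0))
          + (\<Sum>k<c. q' * ((real k - real c) * q0))) (at_right 0)"
      by (intro tendsto_intros q_rate u_lim v_lim u_rate v_rate)
    moreover have "(\<Sum>k<a. q' * (real k * q0)) - \<kappa> * (\<Sum>k=a..<b. q' * (real k * q0))
          + (\<Sum>k<c. q' * ((real k - real c) * q0)) = - 2 * (real c)\<^sup>2 * q' * q0"
    proof -
      have mid: "(\<Sum>k=a..<b. real k) = real b * (real b - 1) / 2 - real a * (real a - 1) / 2"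
        using sum.atLeastLessThan_concat[of 0 a b real] ab
        by (simp add: atLeast0LessThan sum_lessThan_real)
      have "(\<Sum>k<a. q' * (real k * q0)) - \<kappa> * (\<Sum>k=a..<b. q' * (real k * q0))
          + (\<Sum>k<c. q' * ((real k - real c) * q0))
        = q' * q0 * ((\<Sum>k<a. real k) - \<kappa> * (\<Sum>k=a..<b. real k)
          + ((\<Sum>k<c. real k) - real c * real c))"
        by (simp add: sum_distrib_left sum_distrib_right sum_subtractf algebra_simps)
      moreover have "(\<Sum>k<a. real k) - \<kappa> * (\<Sum>k=a..<b. real k)
          + ((\<Sum>k<c. real k) - real c * real c) = - 2 * (real c)\<^sup>2"
        unfolding mid sum_lessThan_real ra rb rc \<kappa>_def using den
        by (simp add: divide_simps power2_eq_square) (simp add: algebra_simps)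
      ultimately show ?thesis by simp
    qed
    moreover have "B h / h\<^sup>2 = (\<Sum>k<a. (q ((norm (u h k))\<^sup>2) - q0) / h\<^sup>2)
          - \<kappa> * (\<Sum>k=a..<b. (q ((norm (u h k))\<^sup>2) - q0) / h\<^sup>2)
          + (\<Sum>k<c. (q ((norm (v h k))\<^sup>2) - q0) / h\<^sup>2)" for h
      unfolding B_def sum_divide_distrib[symmetric] by (simp add: add_divide_distrib diff_divide_distrib)
    ultimately show ?thesis by simp
  qed
  moreover have "- 2 * (real c)\<^sup>2 * q' * q0 > 0"
    using q0 q'(2) n2 by (simp add: rc mult_less_0_iff zero_less_mult_iff)
  ultimately have B_pos: "\<forall>\<^sub>F h in at_right 0. B h / h\<^sup>2 > 0" by (rule order_tendstoD)

  show ?thesis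
  proof
    assume "strongly_stable (SSPRK_nsq_3 n) g"
    then obtain dtmax where dtmax: "dtmax > 0"
      and stable: "\<And>dt. dt \<in> {0<..dtmax} \<Longrightarrow> (norm (SSPRK_nsq_3 n g dt u0))\<^sup>2 \<le> (norm u0)\<^sup>2"
      unfolding strongly_stable_def by blast
    have N: "real n * (real n - 1) > 0" using n2 by simp
    have "\<forall>\<^sub>F h in at_right 0. h < dtmax / (real n * (real n - 1))"
      using dtmax N by (intro order_tendstoD(2)[OF tendsto_ident_at]) simp
    with B_pos h_pos have "\<forall>\<^sub>F h in at_right 0. B h / h\<^sup>2 > 0 \<and> h > 0 \<and> h < dtmax / (real n * (real n - 1))"
      by eventually_elim simp
    then obtain h where h: "B h / h\<^sup>2 > 0" "h > 0" "h < dtmax / (real n * (real n - 1))"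
      using eventually_happens' by (metis (no_types, lifting) trivial_limit_at_right_real)
    have "SSPRK_nsq_3 n g (h * (real n * (real n - 1))) u0 = v h c"
      using N by (simp add: SSPRK_nsq_3_def Let_def v_def v0_def u_def a_def b_def c_def \<alpha>_def \<beta>_def)
    moreover have "h * (real n * (real n - 1)) \<in> {0<..dtmax}"
      using h N by (simp add: field_simps)
    ultimately have "(norm (v h c))\<^sup>2 \<le> s0" using stable unfolding s0_def by metis
    moreover have "h\<^sup>2 * B h > 0" using h by (simp add: zero_less_divide_iff)
    ultimately show False using energy[of h] by linarith
  qed
qed

section \<open>Smoothness of rational functions\<close>

text \<open>
  The rational functions whose denominators are powers of \<open>1 + u \<bullet> u\<close>. Smoothness is an induction on
  the order of differentiation over all functions of a class at once, so it needs a class that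
  contains its own directional derivatives. Giving the class by generators reduces this closure to the
  sum and product rules and the derivative of \<open>inverse (1 + u \<bullet> u)\<close>.
\<close>

inductive_set bracket_rational :: "('a::euclidean_space \<Rightarrow> real) set" where
  const: "(\<lambda>u. c) \<in> bracket_rational"
| inner: "(\<lambda>u. u \<bullet> w) \<in> bracket_rational"
| bracket: "(\<lambda>u. inverse (1 + u \<bullet> u)) \<in> bracket_rational"
| add: "p \<in> bracket_rational \<Longrightarrow> r \<in> bracket_rational \<Longrightarrow> (\<lambda>u. p u + r u) \<in> bracket_rational"
| mult: "p \<in> bracket_rational \<Longrightarrow> r \<in> bracket_rational \<Longrightarrow> (\<lambda>u. p u * r u) \<in> bracket_rational"

lemma bracket_rational_derivative:
  assumes "p \<in> bracket_rational"
  shows "\<exists>p'. (\<forall>x. (p has_derivative p' x) (at x)) \<and> (\<forall>v. (\<lambda>x. p' x v) \<in> bracket_rational)"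
  using assms
proof induction
  case (const c)
  show ?case
    by (rule exI[of _ "\<lambda>x v. 0"]) (auto intro: bracket_rational.intros)
next
  case (inner w)
  show ?case
    by (rule exI[of _ "\<lambda>x v. v \<bullet> w"])
      (auto intro: bracket_rational.intros has_derivative_inner_left)
next
  case bracket
  have "((\<lambda>u::'a. inverse (1 + u \<bullet> u)) has_derivative
      (\<lambda>v. (- 2) * (x \<bullet> v) * (inverse (1 + x \<bullet> x) * inverse (1 + x \<bullet> x)))) (at x)" for x
  proof -
    have "1 + x \<bullet> x \<noteq> 0" using inner_ge_zero[of x] by linarith
    then show ?thesis
      by (auto intro!: derivative_eq_intros simp: inner_commute algebra_simps)
  qed
  moreover have "(\<lambda>x. (- 2) * (x \<bullet> v) * (inverse (1 + x \<bullet> x) * inverse (1 + x \<bullet> x))) \<in> bracket_rational" for v :: 'a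
    by (intro bracket_rational.intros)
  ultimately show ?case
    by (intro exI[of _ "\<lambda>x v. (- 2) * (x \<bullet> v) * (inverse (1 + x \<bullet> x) * inverse (1 + x \<bullet> x))"]) blast
next
  case (add p r)
  then obtain p' r' where
    "\<forall>x. (p has_derivative p' x) (at x)" "\<forall>v. (\<lambda>x. p' x v) \<in> bracket_rational"
    "\<forall>x. (r has_derivative r' x) (at x)" "\<forall>v. (\<lambda>x. r' x v) \<in> bracket_rational" by blast
  then show ?case
    by (intro exI[of _ "\<lambda>x v. p' x v + r' x v"])
      (auto intro: bracket_rational.intros has_derivative_add)
next
  case (mult p r)
  then obtain p' r' where
    "\<forall>x. (p has_derivative p' x) (at x)" "\<forall>v. (\<lambda>x. p' x v) \<in> bracket_rational"
    "\<forall>x. (r has_derivative r' x) (at x)" "\<forall>v. (\<lambda>x. r' x v) \<in> bracket_rational" by blast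
  with mult.hyps show ?case
    by (intro exI[of _ "\<lambda>x v. p x * r' x v + p' x v * r x"])
      (auto intro!: bracket_rational.intros has_derivative_mult)
qed

lemma smooth_bracket_rational:
  fixes f :: "'a::euclidean_space \<Rightarrow> 'b::euclidean_space"
  assumes "\<And>i. i \<in> Basis \<Longrightarrow> (\<lambda>x. f x \<bullet> i) \<in> bracket_rational"
  shows "smooth f"
proof -
  have "times_differentiable k f" for k
    using assms
  proof (induction k arbitrary: f)
    case (Suc k)
    have "\<forall>i\<in>Basis. \<exists>p'. (\<forall>x. ((\<lambda>x. f x \<bullet> i) has_derivative p' x) (at x))
        \<and> (\<forall>v. (\<lambda>x. p' x v) \<in> bracket_rational)"
      using Suc.prems bracket_rational_derivative by blast
    from bchoice[OF this] obtain D where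
      D: "\<forall>i\<in>Basis. (\<forall>x. ((\<lambda>x. f x \<bullet> i) has_derivative D i x) (at x))
        \<and> (\<forall>v. (\<lambda>x. D i x v) \<in> bracket_rational)" ..
    define f' where "f' x v = (\<Sum>i\<in>Basis. D i x v *\<^sub>R i)" for x v
    have comp: "f' x v \<bullet> i = D i x v" if "i \<in> Basis" for x v i
      using that by (simp add: f'_def)
    have f': "(f has_derivative f' x) (at x)" for x
      unfolding has_derivative_componentwise_within[of f "f' x" x UNIV]
      using D comp by (simp cong: ball_cong)
    then have "frechet_derivative f (at x) = f' x" for x
      by (metis frechet_derivative_at)
    moreover have "times_differentiable k (\<lambda>x. f' x v)" for v
      by (rule Suc.IH) (use D comp in simp)
    ultimately show ?case using f' by (auto simp: differentiable_def)
  qed simp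
  then show ?thesis by (simp add: smooth_def)
qed

section \<open>A Lipschitz rotation field of the plane that slows down outwards\<close>

text \<open>
  Over the common denominator, the numerator of the difference is
  \<open>(x - y) + ((norm y)\<^sup>2 *\<^sub>R x - (norm x)\<^sup>2 *\<^sub>R y)\<close>. By the distance formula for inversion in the unit
  sphere the second summand has norm \<open>norm x * norm y * norm (x - y)\<close>, and
  \<open>1 + norm x * norm y\<close> is at most the denominator.
\<close>

lemma norm_diff_div_bracket_le:
  fixes x y :: "'a::real_inner"
  shows "norm (x /\<^sub>R (1 + x \<bullet> x) - y /\<^sub>R (1 + y \<bullet> y)) \<le> norm (x - y)"
proof -
  define X Y where "X = norm x" and "Y = norm y"
  have X: "x \<bullet> x = X\<^sup>2" and Y: "y \<bullet> y = Y\<^sup>2" by (simp_all add: X_def Y_def dot_square_norm)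
  have pos: "1 + X\<^sup>2 > 0" "1 + Y\<^sup>2 > 0" by (simp_all add: add_pos_nonneg)
  have "(norm (Y\<^sup>2 *\<^sub>R x - X\<^sup>2 *\<^sub>R y))\<^sup>2 = (X * Y * norm (x - y))\<^sup>2"
    unfolding power_mult_distrib power2_norm_eq_inner
    by (simp add: inner_diff_left inner_diff_right X Y inner_commute[of y x] algebra_simps power2_eq_square)
  then have inv: "norm (Y\<^sup>2 *\<^sub>R x - X\<^sup>2 *\<^sub>R y) = X * Y * norm (x - y)"
    by (rule power2_eq_imp_eq) (simp_all add: X_def Y_def)
  have "x /\<^sub>R (1 + X\<^sup>2) - y /\<^sub>R (1 + Y\<^sup>2)
      = ((x - y) + (Y\<^sup>2 *\<^sub>R x - X\<^sup>2 *\<^sub>R y)) /\<^sub>R ((1 + X\<^sup>2) * (1 + Y\<^sup>2))"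
  proof -
    have "x /\<^sub>R (1 + X\<^sup>2) = ((1 + Y\<^sup>2) *\<^sub>R x) /\<^sub>R ((1 + X\<^sup>2) * (1 + Y\<^sup>2))"
      "y /\<^sub>R (1 + Y\<^sup>2) = ((1 + X\<^sup>2) *\<^sub>R y) /\<^sub>R ((1 + X\<^sup>2) * (1 + Y\<^sup>2))"
      using pos by simp_all
    then show ?thesis by (simp add: scaleR_diff_right[symmetric] algebra_simps)
  qed
  then have "norm (x /\<^sub>R (1 + X\<^sup>2) - y /\<^sub>R (1 + Y\<^sup>2))
      = norm ((x - y) + (Y\<^sup>2 *\<^sub>R x - X\<^sup>2 *\<^sub>R y)) / ((1 + X\<^sup>2) * (1 + Y\<^sup>2))"
    using pos by (simp add: divide_inverse mult.commute)
  also have "\<dots> \<le> (1 + X * Y) * norm (x - y) / ((1 + X\<^sup>2) * (1 + Y\<^sup>2))"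
    using pos norm_triangle_ineq[of "x - y" "Y\<^sup>2 *\<^sub>R x - X\<^sup>2 *\<^sub>R y"]
    by (intro divide_right_mono) (simp_all add: inv algebra_simps)
  also have "\<dots> \<le> norm (x - y)"
  proof -
    have "2 * (X * Y) \<le> X\<^sup>2 + Y\<^sup>2" using sum_squares_bound[of X Y] by simp
    moreover have "X\<^sup>2 \<ge> 0" "Y\<^sup>2 \<ge> 0" "X\<^sup>2 * Y\<^sup>2 \<ge> 0" by simp_all
    ultimately have "1 + X * Y \<le> (1 + X\<^sup>2) * (1 + Y\<^sup>2)"
      unfolding ring_distribs mult_1_left mult_1_right by linarith
    then have "(1 + X * Y) * norm (x - y) \<le> (1 + X\<^sup>2) * (1 + Y\<^sup>2) * norm (x - y)"
      by (intro mult_right_mono) auto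
    then show ?thesis using pos by (simp add: divide_le_eq mult.commute)
  qed
  finally show ?thesis by (simp add: X Y)
qed

definition rot :: "real ^ 2 \<Rightarrow> real ^ 2" where
  "rot u = vector [- (u $ 2), u $ 1]"

lemma linear_rot: "linear rot"
  by (rule linearI) (simp_all add: rot_def vec_eq_iff forall_2)

lemma rot_orthogonal: "u \<bullet> rot u = 0"
  by (simp add: rot_def inner_vec_def sum_2)

lemma norm_rot: "norm (rot u) = norm u"
  by (simp add: rot_def norm_eq_sqrt_inner inner_vec_def sum_2 add.commute)

definition slowing_rotation :: "real \<Rightarrow> real ^ 2 \<Rightarrow> real ^ 2" where
  "slowing_rotation L u = (L / (1 + u \<bullet> u)) *\<^sub>R rot u"

lemma smooth_slowing_rotation: "smooth (slowing_rotation L)"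
proof (rule smooth_bracket_rational)
  fix i :: "real ^ 2" assume "i \<in> Basis"
  have "slowing_rotation L u \<bullet> i = L * inverse (1 + u \<bullet> u) * (u \<bullet> vector [i $ 2, - (i $ 1)])" for u
    by (simp add: slowing_rotation_def rot_def inner_vec_def sum_2 divide_inverse algebra_simps)
  then show "(\<lambda>u. slowing_rotation L u \<bullet> i) \<in> bracket_rational"
    by (simp only:) (intro bracket_rational.intros)
qed

lemma lip_slowing_rotation:
  assumes "L > 0"
  shows "lip_seminorm (slowing_rotation L) \<le> ennreal L"
proof -
  have *: "norm (slowing_rotation L u - slowing_rotation L v) \<le> L * norm (u - v)" for u v
  proof -
    have "slowing_rotation L w = L *\<^sub>R rot (w /\<^sub>R (1 + w \<bullet> w))" for w
      by (simp add: slowing_rotation_def linear_scale[OF linear_rot] divide_inverse)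
    then have "slowing_rotation L u - slowing_rotation L v
        = L *\<^sub>R rot (u /\<^sub>R (1 + u \<bullet> u) - v /\<^sub>R (1 + v \<bullet> v))"
      by (simp only: linear_diff[OF linear_rot] scaleR_diff_right)
    then have "norm (slowing_rotation L u - slowing_rotation L v)
        = L * norm (u /\<^sub>R (1 + u \<bullet> u) - v /\<^sub>R (1 + v \<bullet> v))"
      using assms by (simp only: norm_scaleR norm_rot abs_of_pos)
    then show ?thesis
      using norm_diff_div_bracket_le[of u v] assms by (simp only: mult_left_mono less_imp_le)
  qed
  have "norm (slowing_rotation L u - slowing_rotation L v) / norm (u - v) \<le> L" if "u \<noteq> v" for u v
    using *[of u v] that by (simp add: divide_le_eq)
  then show ?thesis
    unfolding lip_seminorm_def by (auto intro!: SUP_least ennreal_leI)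
qed

theorem theorem4p2:
  fixes L :: real and n :: nat
  assumes "L > 0" and "n \<ge> 2"
  shows "\<exists>g :: real ^ 2 \<Rightarrow> real ^ 2.
           smooth g \<and> semibounded g \<and> lip_seminorm g \<le> ennreal L \<and>
           \<not> strongly_stable (SSPRK_nsq_3 n) g"
proof (intro exI conjI)
  let ?g = "slowing_rotation L"
  show smooth: "smooth ?g" by (rule smooth_slowing_rotation)
  have orth: "u \<bullet> ?g u = 0" for u
    by (simp add: slowing_rotation_def rot_orthogonal)
  then show "semibounded ?g" by (simp add: semibounded_def)
  show "lip_seminorm ?g \<le> ennreal L" by (rule lip_slowing_rotation[OF assms(1)])
  \<comment> \<open>Here \<open>q s = L\<^sup>2 * s / (1 + s)\<^sup>2\<close> has derivative \<open>L\<^sup>2 * (1 - s) / (1 + s) ^ 3\<close>, negative for \<open>s > 1\<close>;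
    radius 2 means \<open>s = 4\<close>.\<close>
  define u0 :: "real ^ 2" where "u0 = 2 *\<^sub>R axis 1 1"
  have u0: "(norm u0)\<^sup>2 = 4" by (simp add: u0_def)
  show "\<not> strongly_stable (SSPRK_nsq_3 n) ?g"
  proof (rule SSPRK_nsq_3_not_strongly_stable[where ?u0.0 = u0
        and q = "\<lambda>s. L\<^sup>2 * s / (1 + s)\<^sup>2" and q' = "- 3 * L\<^sup>2 / 125"])
    show "(norm (?g u))\<^sup>2 = L\<^sup>2 * (norm u)\<^sup>2 / (1 + (norm u)\<^sup>2)\<^sup>2" for u
      by (simp add: slowing_rotation_def norm_rot power_mult_distrib power_divide dot_square_norm)
    from smooth have "times_differentiable (Suc 0) ?g" unfolding smooth_def by blast
    then show "isCont ?g u0" by (simp add: differentiable_imp_continuous_within)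
    have "?g u0 = 0 \<Longrightarrow> False"
    proof -
      assume "?g u0 = 0"
      then have "(norm (?g u0))\<^sup>2 = 0" by simp
      then show False
        using u0 assms(1) by (simp add: slowing_rotation_def norm_rot dot_square_norm)
    qed
    then show "?g u0 \<noteq> 0" by blast
    show "((\<lambda>s. L\<^sup>2 * s / (1 + s)\<^sup>2) has_real_derivative - 3 * L\<^sup>2 / 125) (at ((norm u0)\<^sup>2))"
      unfolding u0 by (auto intro!: derivative_eq_intros simp: field_simps)
    show "- 3 * L\<^sup>2 / 125 < 0" using assms(1) by simp
  qed (use assms(2) orth in auto)
qed

end
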